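(* Let $H$ be a homogeneous relation on a finite set $X$, and for a non-empty $A\subseteq X$ let $s(A)$ be the number of splitters of $A$. Then for all $A,B\subseteq X$ with $A\cap B\neq\emptyset$, $$s(A)+s(B)\geq s(A\cup B)+s(A\cap B).$$
   Context: A diverse triple of $X$ is $(x,y,z)\in X^3$ with $x\neq y$, $x\neq z$, written $(x|yz)$. A homogeneous relation $H$ on $X$ is a relation on diverse triples such that for every $x\in X$ the relation $H_x(y,z)\Leftrightarrow H(x|yz)$ is an equivalence relation on $X\setminus\{x\}$. A splitter of a set $A\subseteq X$ is an element $x\in X\setminus A$ such that $\neg H(x|yz)$ for some $y,z\in A$. *)

theory Defs
  imports Main
begin

text \<open>The diverse triple $(x|yz)$ is encoded as \<open>(x, y, z)\<close>; the case \<open>y = z\<close> is allowed.\<close>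

definition diverse_triples :: "'a set \<Rightarrow> ('a \<times> 'a \<times> 'a) set" where
  "diverse_triples X = {(x, y, z). x \<in> X \<and> y \<in> X \<and> z \<in> X \<and> x \<noteq> y \<and> x \<noteq> z}"

definition homogeneous_relation :: "'a set \<Rightarrow> ('a \<times> 'a \<times> 'a) set \<Rightarrow> bool" where
  "homogeneous_relation X H \<longleftrightarrow>
     H \<subseteq> diverse_triples X \<and>
     (\<forall>x\<in>X. equiv (X - {x}) {(y, z). (x, y, z) \<in> H})"

definition splitter :: "'a set \<Rightarrow> ('a \<times> 'a \<times> 'a) set \<Rightarrow> 'a set \<Rightarrow> 'a \<Rightarrow> bool" where
  "splitter X H A x \<longleftrightarrow> x \<in> X - A \<and> (\<exists>y\<in>A. \<exists>z\<in>A. (x, y, z) \<notin> H)"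

definition num_splitters :: "'a set \<Rightarrow> ('a \<times> 'a \<times> 'a) set \<Rightarrow> 'a set \<Rightarrow> nat" where
  "num_splitters X H A = card {x. splitter X H A x}"

end

theory Submission
  imports Defs
begin

text \<open>Write \<open>S(C)\<close> for the set of splitters of \<open>C\<close>. Then
  \<open>S(A \<union> B) \<union> S(A \<inter> B) \<subseteq> S(A) \<union> S(B)\<close> and
  \<open>S(A \<union> B) \<inter> S(A \<inter> B) \<subseteq> S(A) \<inter> S(B)\<close>, so the inequality follows by counting
  unions and intersections. Only the inclusion \<open>S(A \<union> B) \<subseteq> S(A) \<union> S(B)\<close> uses that \<open>A\<close> and
  \<open>B\<close> meet: a common element connects \<open>A\<close> and \<open>B\<close> by transitivity of \<open>H\<^sub>x\<close>.\<close>

lemma homogeneous_relation_sym: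
  assumes "homogeneous_relation X H" "(x, y, z) \<in> H"
  shows "(x, z, y) \<in> H"
proof -
  \<comment> \<open>The equivalence property is given only for points of \<open>X\<close>;
    \<open>H\<close> consisting of diverse triples puts \<open>x\<close> there.\<close>
  have "x \<in> X"
    using assms unfolding homogeneous_relation_def diverse_triples_def by auto
  then have "sym {(y, z). (x, y, z) \<in> H}"
    using assms(1) unfolding homogeneous_relation_def by (blast elim: equivE)
  then show ?thesis
    using assms(2) by (auto dest: symD)
qed

lemma homogeneous_relation_trans:
  assumes "homogeneous_relation X H" "(x, y, w) \<in> H" "(x, w, z) \<in> H"
  shows "(x, y, z) \<in> H"
proof -
  have "x \<in> X"
    using assms unfolding homogeneous_relation_def diverse_triples_def by auto
  then have "trans {(y, z). (x, y, z) \<in> H}"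
    using assms(1) unfolding homogeneous_relation_def by (blast elim: equivE)
  then show ?thesis
    using assms(2,3) by (auto dest: transD)
qed

lemma splitter_mono:
  assumes "splitter X H A x" "A \<subseteq> B" "x \<notin> B"
  shows "splitter X H B x"
  using assms unfolding splitter_def by blast

lemma splitter_Un:
  assumes "homogeneous_relation X H" "A \<inter> B \<noteq> {}" "splitter X H (A \<union> B) x"
  shows "splitter X H A x \<or> splitter X H B x"
proof (rule ccontr)
  assume no_split: "\<not> (splitter X H A x \<or> splitter X H B x)"
  obtain c where c: "c \<in> A" "c \<in> B"
    using assms(2) by blast
  have x: "x \<in> X - A" "x \<in> X - B"
    using assms(3) unfolding splitter_def by auto
  \<comment> \<open>Each such \<open>y\<close> shares \<open>A\<close> or \<open>B\<close> with
    \<open>c\<close>, and \<open>x\<close> lies outside both sets and splits neither.\<close>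
  have to_c: "(x, y, c) \<in> H" if "y \<in> A \<union> B" for y
    using that no_split c x unfolding splitter_def by blast
  have "(x, y, z) \<in> H" if "y \<in> A \<union> B" "z \<in> A \<union> B" for y z
    using homogeneous_relation_trans[OF assms(1) to_c[OF that(1)]]
      homogeneous_relation_sym[OF assms(1) to_c[OF that(2)]] by blast
  then show False
    using assms(3) unfolding splitter_def by blast
qed

text \<open>Being outside the intersection, \<open>x\<close> misses \<open>A\<close> or
  \<open>B\<close>, and the unrelated pair lies in both, so \<open>x\<close> splits whichever set it
  misses.\<close>

lemma splitter_Int:
  assumes "splitter X H (A \<inter> B) x"
  shows "splitter X H A x \<or> splitter X H B x"
  using assms unfolding splitter_def by blast

theorem theorem1:
  fixes X :: "'a set" and H :: "('a \<times> 'a \<times> 'a) set"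
  assumes "finite X"
    and "homogeneous_relation X H"
  shows "\<forall>A B. A \<subseteq> X \<longrightarrow> B \<subseteq> X \<longrightarrow> A \<inter> B \<noteq> {} \<longrightarrow>
           num_splitters X H A + num_splitters X H B
             \<ge> num_splitters X H (A \<union> B) + num_splitters X H (A \<inter> B)"
proof (intro allI impI)
  fix A B :: "'a set"
  assume meet: "A \<inter> B \<noteq> {}"
  define S where "S C = {x. splitter X H C x}" for C
  have finite_S: "finite (S C)" for C
    by (rule finite_subset[OF _ assms(1)]) (auto simp: S_def splitter_def)
  have union: "S (A \<union> B) \<union> S (A \<inter> B) \<subseteq> S A \<union> S B"
    using splitter_Un[OF assms(2) meet] splitter_Int by (fastforce simp: S_def)
  have inter: "S (A \<union> B) \<inter> S (A \<inter> B) \<subseteq> S A \<inter> S B"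
  proof
    fix x
    assume x: "x \<in> S (A \<union> B) \<inter> S (A \<inter> B)"
    \<comment> \<open>From splitting \<open>A \<union> B\<close> only this is used; the unrelated
      pair comes from \<open>A \<inter> B\<close>.\<close>
    then have "x \<notin> A" "x \<notin> B"
      by (auto simp: S_def splitter_def)
    with x show "x \<in> S A \<inter> S B"
      by (auto simp: S_def intro: splitter_mono[of X H "A \<inter> B"])
  qed
  have "card (S (A \<union> B)) + card (S (A \<inter> B))
      = card (S (A \<union> B) \<union> S (A \<inter> B)) + card (S (A \<union> B) \<inter> S (A \<inter> B))"
    by (rule card_Un_Int[OF finite_S finite_S])
  also have "\<dots> \<le> card (S A \<union> S B) + card (S A \<inter> S B)"
    using union inter finite_S by (intro add_mono card_mono) auto
  also have "\<dots> = card (S A) + card (S B)"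
    by (rule card_Un_Int[OF finite_S finite_S, symmetric])
  finally show "num_splitters X H (A \<union> B) + num_splitters X H (A \<inter> B)
      \<le> num_splitters X H A + num_splitters X H B"
    by (simp add: num_splitters_def S_def)
qed

end
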